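(* Suppose the mean vectors $\mu_{\tilde c},\mu_{\tilde d^k}$ and upper and lower bound vectors $\tilde c^u,\tilde c^l$ of $\tilde c$ and $\tilde d^{ku},\tilde d^{kl}$ of $\tilde d^k$, $k\in\mathbb{K}$, are known, and that the components of $\tilde c$ are independent and, for each $k$, the components of $\tilde d^k$ are independent. Let $h_0^{rc}>0$ and $h_k^{rc}>0$, $k\in\mathbb{K}$, be arbitrarily fixed constants, and put, for $(s,a)\in\mathcal{K}$, $k\in\mathbb{K}$, $$A_{\tilde c}(s,a)=\frac{\mu_{\tilde c}(s,a)-\tilde c^l(s,a)}{\tilde c^u(s,a)-\tilde c^l(s,a)},\qquad A_{\tilde d^k}(s,a)=\frac{\mu_{\tilde d^k}(s,a)-\tilde d^{kl}(s,a)}{\tilde d^{ku}(s,a)-\tilde d^{kl}(s,a)}.$$ Then the following problem is a convex programming problem and its optimal value is an upper bound to the optimal value of the individual chance-constrained problem (ICCP) defined in the context: $$\min_{z,\rho,(y_k)_{k\in\mathbb{K}}} z\quad\text{subject to}$$ $$\sum_{(s,a)\in\mathcal{K}}\ln\Big\{A_{\tilde c}(s,a)\exp\big(h_0^{rc}\rho(s,a)\tilde c^u(s,a)\big)+\big(1-A_{\tilde c}(s,a)\big)\exp\big(h_0^{rc}\rho(s,a)\tilde c^l(s,a)\big)\Big\}\le\ln(1-p_0)+h_0^{rc}z,$$ $$\sum_{(s,a)\in\mathcal{K}}\ln\Big\{A_{\tilde d^k}(s,a)\exp\big(h_k^{rc}\rho(s,a)\tilde d^{ku}(s,a)\big)+\big(1-A_{\tilde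 d^k}(s,a)\big)\exp\big(h_k^{rc}\rho(s,a)\tilde d^{kl}(s,a)\big)\Big\}\le\ln\big(1-p_1^{y_k^{1/\theta}}\big)+h_k^{rc}\xi_k\ \ \forall k\in\mathbb{K},$$ $$\sum_{k\in\mathbb{K}}y_k=1,\quad y_k\ge0\ \ \forall k\in\mathbb{K},\quad\rho\in\mathcal{Q}^\alpha(\gamma).$$
   Context: $S$ is a finite nonempty state space, $A(s)$ a finite nonempty action set for each $s\in S$, $\mathcal{K}=\{(s,a): s\in S,\ a\in A(s)\}$, $\alpha\in(0,1)$ a discount factor, $\gamma$ a probability distribution on $S$, $p(s'|s,a)$ known transition probabilities, and $\delta$ the Kronecker delta. Define $$\mathcal{Q}^\alpha(\gamma)=\Big\{\rho\in\mathbb{R}^{|\mathcal{K}|}:\ \sum_{(s,a)\in\mathcal{K}}\rho(s,a)\big(\delta(s',s)-\alpha p(s'|s,a)\big)=(1-\alpha)\gamma(s')\ \forall s'\in S,\ \ \rho(s,a)\ge 0\ \forall (s,a)\in\mathcal{K}\Big\}.$$ Let $\mathbb{K}=\{1,\dots,K\}$, $\xi_k\in\mathbb{R}$, $p_0,p_1\in(0,1)$, $\theta\ge1$. The running cost vectors $\tilde c=(\tilde c(s,a))_{(s,a)\in\mathcal{K}}$ and $\tilde d^k=(\tilde d^k(s,a))_{(s,a)\in\mathcal{K}}$, $k\in\mathbb{K}$, are random vectors on a probability space $(\Omega,\mathcal{F},\mathbb{P})$. The individual chance-constrained problem is $$(\mathrm{ICCP})\quad \min_{z,\rho,(y_k)_{k\in\mathbb{K}}}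 z\ \ \text{s.t.}\ \ \mathbb{P}(\rho^T\tilde c\le z)\ge p_0,\quad \mathbb{P}(\rho^T\tilde d^k\le\xi_k)\ge p_1^{y_k^{1/\theta}}\ \forall k\in\mathbb{K},\quad \rho\in\mathcal{Q}^\alpha(\gamma),\ \sum_{k\in\mathbb{K}}y_k=1,\ y_k\ge0\ \forall k\in\mathbb{K}.$$ Conventions: the optimal value of a minimization problem is the infimum of its objective over its feasible set ($+\infty$ if infeasible). "Upper/lower bound vectors" means $\tilde c^l(s,a)\le\tilde c(s,a)\le\tilde c^u(s,a)$ for all $(s,a)$ and all realizations; similarly for $\tilde d^{ku},\tilde d^{kl}$; it is assumed that $\tilde c^l(s,a)<\tilde c^u(s,a)$ and $\tilde d^{kl}(s,a)<\tilde d^{ku}(s,a)$, so that $A_{\tilde c},A_{\tilde d^k}$ are defined. $\ln 0=-\infty$ (so the constraint for $k$ fails when $y_k=0$). "Convex programming problem" means a linear objective, with all constraints being linear or of the form $g\le0$ with $g$ a convex (extended-valued) function of the variables. *)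

theory Defs
  imports "HOL-Probability.Probability"
begin

section \<open>Optimization problems\<close>

text \<open>
  A problem consists of a linear decision space, an objective to be minimized, equality
  constraints \<open>f x = 0\<close>, inequality constraints \<open>f x \<le> 0\<close> meant to be linear, and constraints
  \<open>g x \<le> 0\<close> with an extended-valued \<open>g\<close>, where the value \<open>\<infinity>\<close> makes \<open>x\<close> infeasible.
\<close>

record 'v program =
  dec_space :: "'v set"
  objective :: "'v \<Rightarrow> real"
  eq_cons :: "('v \<Rightarrow> real) set"
  lin_cons :: "('v \<Rightarrow> real) set"
  ext_cons :: "('v \<Rightarrow> ereal) set"

definition feasible_set :: "'v program \<Rightarrow> 'v set" where
  "feasible_set P = {x \<in> dec_space P. (\<forall>f \<in> eq_cons P. f x = 0) \<and>
     (\<forall>f \<in> lin_cons P. f x \<le> 0) \<and> (\<forall>g \<in> ext_cons P. g x \<le> 0)}"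

text \<open>The infimum is taken in the extended reals, so it is \<open>\<infinity>\<close> for an infeasible problem.\<close>

definition opt_value :: "('v \<Rightarrow> real) \<Rightarrow> 'v set \<Rightarrow> ereal" where
  "opt_value f F = (INF x \<in> F. ereal (f x))"

definition linear_fun_on :: "'v::real_vector set \<Rightarrow> ('v \<Rightarrow> real) \<Rightarrow> bool" where
  "linear_fun_on D f \<longleftrightarrow> (\<exists>l. linear l \<and> (\<forall>x \<in> D. f x = l x))"

definition affine_fun_on :: "'v::real_vector set \<Rightarrow> ('v \<Rightarrow> real) \<Rightarrow> bool" where
  "affine_fun_on D f \<longleftrightarrow> (\<exists>l b. linear l \<and> (\<forall>x \<in> D. f x = l x + b))"

text \<open>Convexity of an extended-valued function is convexity of its epigraph.\<close>

definition convex_ext_on :: "'v::real_vector set \<Rightarrow> ('v \<Rightarrow> ereal) \<Rightarrow> bool" where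
  "convex_ext_on D g \<longleftrightarrow> convex {(x, t :: real). x \<in> D \<and> g x \<le> ereal t}"

definition convex_program :: "'v::real_vector program \<Rightarrow> bool" where
  "convex_program P \<longleftrightarrow>
     subspace (dec_space P) \<and>
     linear_fun_on (dec_space P) (objective P) \<and>
     (\<forall>f \<in> eq_cons P \<union> lin_cons P. affine_fun_on (dec_space P) f) \<and>
     (\<forall>g \<in> ext_cons P. convex_ext_on (dec_space P) g)"

section \<open>The Markov decision process and the chance-constrained problem\<close>

definition state_actions :: "('s \<Rightarrow> 'a set) \<Rightarrow> ('s \<times> 'a) set" where
  "state_actions Act = (SIGMA s:UNIV. Act s)"

text \<open>
  Vectors indexed by a set \<open>K\<close> of state-action pairs are represented by the elements of
  \<open>real ^ ('s \<times> 'a)\<close> that vanish outside \<open>K\<close>.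
\<close>

definition vecs_on :: "('s::finite \<times> 'a::finite) set \<Rightarrow> (real ^ ('s \<times> 'a)) set" where
  "vecs_on K = {\<rho>. \<forall>i. i \<notin> K \<longrightarrow> \<rho> $ i = 0}"

text \<open>Left-hand side minus right-hand side of the balance equation for the state \<open>s'\<close>.\<close>

definition balance ::
  "('s::finite \<Rightarrow> 'a::finite set) \<Rightarrow> real \<Rightarrow> 's pmf \<Rightarrow> ('s \<Rightarrow> 'a \<Rightarrow> 's pmf) \<Rightarrow> 's \<Rightarrow>
     real ^ ('s \<times> 'a) \<Rightarrow> real" where
  "balance Act \<alpha> \<gamma> p s' \<rho> =
     (\<Sum>(s, a) \<in> state_actions Act. \<rho> $ (s, a) * (of_bool (s' = s) - \<alpha> * pmf (p s a) s'))
       - (1 - \<alpha>) * pmf \<gamma> s'"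

definition occupation_polytope ::
  "('s::finite \<Rightarrow> 'a::finite set) \<Rightarrow> real \<Rightarrow> 's pmf \<Rightarrow> ('s \<Rightarrow> 'a \<Rightarrow> 's pmf) \<Rightarrow>
     (real ^ ('s \<times> 'a)) set" where
  "occupation_polytope Act \<alpha> \<gamma> p =
     {\<rho> \<in> vecs_on (state_actions Act). (\<forall>s'. balance Act \<alpha> \<gamma> p s' \<rho> = 0) \<and>
        (\<forall>i \<in> state_actions Act. \<rho> $ i \<ge> 0)}"

type_synonym ('s, 'a, 'k) decision = "real \<times> (real ^ ('s \<times> 'a)) \<times> (real ^ 'k)"

definition iccp_feasible ::
  "('s::finite \<Rightarrow> 'a::finite set) \<Rightarrow> real \<Rightarrow> 's pmf \<Rightarrow> ('s \<Rightarrow> 'a \<Rightarrow> 's pmf) \<Rightarrow>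
     'w measure \<Rightarrow> ('s \<times> 'a \<Rightarrow> 'w \<Rightarrow> real) \<Rightarrow> ('k::finite \<Rightarrow> 's \<times> 'a \<Rightarrow> 'w \<Rightarrow> real) \<Rightarrow>
     ('k \<Rightarrow> real) \<Rightarrow> real \<Rightarrow> real \<Rightarrow> real \<Rightarrow> ('s, 'a, 'k) decision set" where
  "iccp_feasible Act \<alpha> \<gamma> p M c d \<xi> p0 p1 \<theta> =
     {(z, \<rho>, y).
        measure M {\<omega> \<in> space M. (\<Sum>i \<in> state_actions Act. \<rho> $ i * c i \<omega>) \<le> z} \<ge> p0 \<and>
        (\<forall>k. measure M {\<omega> \<in> space M. (\<Sum>i \<in> state_actions Act. \<rho> $ i * d k i \<omega>) \<le> \<xi> k}
               \<ge> p1 powr (y $ k powr (1 / \<theta>))) \<and>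
        \<rho> \<in> occupation_polytope Act \<alpha> \<gamma> p \<and>
        (\<Sum>k \<in> UNIV. y $ k) = 1 \<and> (\<forall>k. y $ k \<ge> 0)}"

definition iccp_value ::
  "('s::finite \<Rightarrow> 'a::finite set) \<Rightarrow> real \<Rightarrow> 's pmf \<Rightarrow> ('s \<Rightarrow> 'a \<Rightarrow> 's pmf) \<Rightarrow>
     'w measure \<Rightarrow> ('s \<times> 'a \<Rightarrow> 'w \<Rightarrow> real) \<Rightarrow> ('k::finite \<Rightarrow> 's \<times> 'a \<Rightarrow> 'w \<Rightarrow> real) \<Rightarrow>
     ('k \<Rightarrow> real) \<Rightarrow> real \<Rightarrow> real \<Rightarrow> real \<Rightarrow> ereal" where
  "iccp_value Act \<alpha> \<gamma> p M c d \<xi> p0 p1 \<theta> =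
     opt_value (\<lambda>(z, \<rho>, y). z) (iccp_feasible Act \<alpha> \<gamma> p M c d \<xi> p0 p1 \<theta>)"

section \<open>The convex approximation\<close>

definition bound_weight :: "('i \<Rightarrow> real) \<Rightarrow> ('i \<Rightarrow> real) \<Rightarrow> ('i \<Rightarrow> real) \<Rightarrow> 'i \<Rightarrow> real" where
  "bound_weight \<mu> u l i = (\<mu> i - l i) / (u i - l i)"

definition log_mgf_bound ::
  "'i set \<Rightarrow> real \<Rightarrow> ('i \<Rightarrow> real) \<Rightarrow> ('i \<Rightarrow> real) \<Rightarrow> ('i \<Rightarrow> real) \<Rightarrow> real ^ 'i::finite \<Rightarrow> real" where
  "log_mgf_bound K h \<mu> u l \<rho> =
     (\<Sum>i \<in> K. ln (bound_weight \<mu> u l i * exp (h * \<rho> $ i * u i) +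
                   (1 - bound_weight \<mu> u l i) * exp (h * \<rho> $ i * l i)))"

definition ext_ln :: "real \<Rightarrow> ereal" where
  "ext_ln x = (if x \<le> 0 then - \<infinity> else ereal (ln x))"

text \<open>
  The extended-valued \<open>ln (1 - p1 ^ (y ^ (1/\<theta>)))\<close>. At \<open>y = 0\<close> it is \<open>- \<infinity>\<close>. For \<open>y < 0\<close>, where the
  real power is mathematically undefined (and the library's \<open>y powr a\<close> is a junk value), it is
  also set to \<open>- \<infinity>\<close>, the usual extension of a concave function beyond its domain; feasibility is
  not affected since \<open>y \<ge> 0\<close> is itself a constraint.
\<close>

definition log_risk :: "real \<Rightarrow> real \<Rightarrow> real \<Rightarrow> ereal" where
  "log_risk p1 \<theta> y = (if y < 0 then - \<infinity> else ext_ln (1 - p1 powr (y powr (1 / \<theta>))))"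

definition rc_program ::
  "('s::finite \<Rightarrow> 'a::finite set) \<Rightarrow> real \<Rightarrow> 's pmf \<Rightarrow> ('s \<Rightarrow> 'a \<Rightarrow> 's pmf) \<Rightarrow>
     ('s \<times> 'a \<Rightarrow> real) \<Rightarrow> ('s \<times> 'a \<Rightarrow> real) \<Rightarrow> ('s \<times> 'a \<Rightarrow> real) \<Rightarrow>
     ('k::finite \<Rightarrow> 's \<times> 'a \<Rightarrow> real) \<Rightarrow> ('k \<Rightarrow> 's \<times> 'a \<Rightarrow> real) \<Rightarrow> ('k \<Rightarrow> 's \<times> 'a \<Rightarrow> real) \<Rightarrow>
     ('k \<Rightarrow> real) \<Rightarrow> real \<Rightarrow> real \<Rightarrow> real \<Rightarrow> real \<Rightarrow> ('k \<Rightarrow> real) \<Rightarrow>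
     ('s, 'a, 'k) decision program" where
  "rc_program Act \<alpha> \<gamma> p \<mu>c cu cl \<mu>d du dl \<xi> p0 p1 \<theta> h0 h =
     \<lparr> dec_space = UNIV \<times> vecs_on (state_actions Act) \<times> UNIV,
       objective = (\<lambda>(z, \<rho>, y). z),
       eq_cons = {\<lambda>(z, \<rho>, y). (\<Sum>k \<in> UNIV. y $ k) - 1}
         \<union> (\<Union>s'. {\<lambda>(z, \<rho>, y). balance Act \<alpha> \<gamma> p s' \<rho>}),
       lin_cons = (\<Union>k. {\<lambda>(z, \<rho>, y). - y $ k})
         \<union> (\<Union>i \<in> state_actions Act. {\<lambda>(z, \<rho>, y). - \<rho> $ i}),
       ext_cons =
         {\<lambda>(z, \<rho>, y). ereal (log_mgf_bound (state_actions Act) h0 \<mu>c cu cl \<rho>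
                               - (ln (1 - p0) + h0 * z))}
         \<union> (\<Union>k. {\<lambda>(z, \<rho>, y). ereal (log_mgf_bound (state_actions Act) (h k) (\<mu>d k) (du k) (dl k) \<rho>)
                               - (log_risk p1 \<theta> (y $ k) + ereal (h k * \<xi> k))}) \<rparr>"

text \<open>The feasible set of the approximation in displayed form.\<close>

lemma feasible_set_rc_program:
  "feasible_set (rc_program Act \<alpha> \<gamma> p \<mu>c cu cl \<mu>d du dl \<xi> p0 p1 \<theta> h0 h) =
     {(z, \<rho>, y).
        log_mgf_bound (state_actions Act) h0 \<mu>c cu cl \<rho> \<le> ln (1 - p0) + h0 * z \<and>
        (\<forall>k. ereal (log_mgf_bound (state_actions Act) (h k) (\<mu>d k) (du k) (dl k) \<rho>)
               \<le> ext_ln (1 - p1 powr (y $ k powr (1 / \<theta>))) + ereal (h k * \<xi> k)) \<and>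
        (\<Sum>k \<in> UNIV. y $ k) = 1 \<and> (\<forall>k. y $ k \<ge> 0) \<and>
        \<rho> \<in> occupation_polytope Act \<alpha> \<gamma> p}"
proof -
  have *: "ereal a - (ext_ln x + ereal b) \<le> 0 \<longleftrightarrow> ereal a \<le> ext_ln x + ereal b" for a b x
    by (auto simp: ext_ln_def)
  have **: "(ereal a - (log_risk p1 \<theta> t + ereal b) \<le> 0) \<longleftrightarrow>
      (ereal a \<le> ext_ln (1 - p1 powr (t powr (1 / \<theta>))) + ereal b)" if "t \<ge> 0" for a b t
    using that * by (simp add: log_risk_def)
  show ?thesis
    by (auto simp: feasible_set_def rc_program_def occupation_polytope_def ball_Un ** cong: conj_cong)
qed

end

theory Submission
  imports Defs
begin

text \<open>
  Both assertions come from elementary convexity of the exponential function.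

  Convexity of the program. The objective and all constraints except the logarithmic ones are
  affine. The left-hand side of a logarithmic constraint is a sum over the state-action pairs of
  functions \<open>ln (A * exp (a * x) + (1 - A) * exp (b * x))\<close> of the single coordinate \<open>x = \<rho> $ i\<close>;
  such a function is convex (\<open>convex_on_ln_exp_mix\<close>) as soon as \<open>0 \<le> A \<le> 1\<close>, which holds because
  a mean lies between the bounds (\<open>bound_weight_in_unit\<close>). The right-hand side is affine in \<open>z\<close> for
  the running cost; for the constraint costs it is a constant plus a risk term, where
  \<open>ln (1 - q powr (y powr (1 / \<theta>)))\<close> is concave for \<open>y > 0\<close>: it is the concave function
  \<open>y powr (1 / \<theta>)\<close>, where \<open>1 / \<theta> \<le> 1\<close>, followed by the increasing concave functions \<open>1 - q powr t\<close>
  and \<open>ln\<close> (\<open>concave_on_ln_one_minus_powr_powr\<close>). For \<open>y \<le> 0\<close> the constraint function is infinite,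
  so those points do not enter its epigraph, which is thus the epigraph of a convex real-valued
  function on the convex set \<open>y > 0\<close> (\<open>convex_ext_onI\<close>).

  Upper bound. It suffices that every feasible point of the program is feasible for the
  chance-constrained problem, since both minimize \<open>z\<close>. Let \<open>Y\<close> be the random cost
  \<open>\<Sum>i. \<rho> $ i * X i\<close>. Markov's inequality for \<open>exp (h * Y)\<close> and independence give
  \<open>P (Y > z) \<le> exp (- h * z) * (\<Prod>i. E (exp (h * \<rho> $ i * X i)))\<close>. The graph of an exponential over
  \<open>[l i, u i]\<close> lies below its chord, and taking the expectation of the chord replaces \<open>X i\<close> by its
  mean, so each factor is at most the corresponding factor \<open>A * exp (\<dots>) + (1 - A) * exp (\<dots>)\<close>
  (\<open>expectation_exp_le_bound_weight\<close>). The logarithmic constraint says precisely that the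
  resulting bound is at most one minus the required probability (\<open>prob_weighted_sum_le\<close>).
\<close>

section \<open>Convexity\<close>

lemma convex_on_linear_vimage:
  assumes "linear L" and "convex_on S f"
  shows "convex_on (L -` S) (\<lambda>x. f (L x))"
  using assms convex_linear_vimage[of L S]
  by (auto simp: convex_on_def linear_add linear_cmul)

lemma convex_on_finite_sum:
  assumes "finite I" and "convex S" and "\<And>i. i \<in> I \<Longrightarrow> convex_on S (f i)"
  shows "convex_on S (\<lambda>x. \<Sum>i \<in> I. f i x)"
  using assms(1,3) by induct (auto simp: convex_on_const assms(2) intro: convex_on_add)

lemma concave_on_compose_mono:
  assumes f: "concave_on S f" and g: "concave_on T g" "mono_on T g" and "f ` S \<subseteq> T"
  shows "concave_on S (\<lambda>x. g (f x))"
  unfolding concave_on_iff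
proof (intro conjI ballI allI impI)
  show "convex S" using f by (simp add: concave_on_iff)
  fix x y :: 'a and u v :: real
  assume xy: "x \<in> S" "y \<in> S" and uv: "u \<ge> 0" "v \<ge> 0" "u + v = 1"
  have T: "f x \<in> T" "f y \<in> T" and cT: "convex T"
    using assms xy by (auto simp: concave_on_iff)
  have "u *\<^sub>R x + v *\<^sub>R y \<in> S" using \<open>convex S\<close> xy uv by (simp add: convexD)
  then have "f (u *\<^sub>R x + v *\<^sub>R y) \<in> T" using assms(4) by auto
  moreover have "u * f x + v * f y \<in> T" using convexD[OF cT T uv] by simp
  moreover have "u * f x + v * f y \<le> f (u *\<^sub>R x + v *\<^sub>R y)"
    using f xy uv by (simp add: concave_on_iff)
  ultimately have "g (u * f x + v * f y) \<le> g (f (u *\<^sub>R x + v *\<^sub>R y))"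
    using g(2) by (auto dest: mono_onD)
  moreover have "u * g (f x) + v * g (f y) \<le> g (u * f x + v * f y)"
    using g(1) T uv by (simp add: concave_on_iff)
  ultimately show "u * g (f x) + v * g (f y) \<le> g (f (u *\<^sub>R x + v *\<^sub>R y))" by simp
qed

lemma exp_mix_pos:
  fixes A :: real
  assumes "0 \<le> A" and "A \<le> 1"
  shows "A * exp x + (1 - A) * exp y > 0"
  using assms by (cases "A = 0") (auto intro!: add_pos_nonneg)

text \<open>
  Write \<open>m\<close> for the mixture and \<open>z\<close> for the value on the chord of \<open>ln m\<close>. After normalisation by
  \<open>m x\<close> and \<open>m y\<close> each of the two exponentials is compared separately by convexity of \<open>exp\<close>; the
  normalised weights at \<open>x\<close> sum to one, and likewise at \<open>y\<close>, so averaging the two comparisons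
  gives \<open>m \<cdot> exp (- z) \<le> 1\<close> at the intermediate point. This is Hoelder's inequality for two terms.
\<close>

lemma convex_on_ln_exp_mix:
  fixes A a b :: real
  assumes A: "0 \<le> A" "A \<le> 1"
  shows "convex_on UNIV (\<lambda>x. ln (A * exp (a * x) + (1 - A) * exp (b * x)))"
proof (rule convex_onI)
  fix t x y :: real
  assume t: "0 < t" "t < 1"
  define m where "m = (\<lambda>x. A * exp (a * x) + (1 - A) * exp (b * x))"
  have pos: "m x > 0" for x unfolding m_def by (rule exp_mix_pos[OF A])
  define z where "z = (1 - t) * ln (m x) + t * ln (m y)"
  have tilt: "exp (r * ((1 - t) * x + t * y) - z)
      \<le> (1 - t) * (exp (r * x) / m x) + t * (exp (r * y) / m y)" for r
  proof -
    have "exp (r * ((1 - t) * x + t * y) - z)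
        = exp ((1 - t) *\<^sub>R (r * x - ln (m x)) + t *\<^sub>R (r * y - ln (m y)))"
      by (simp add: z_def algebra_simps)
    also have "\<dots> \<le> (1 - t) * exp (r * x - ln (m x)) + t * exp (r * y - ln (m y))"
      using t by (intro convex_onD[OF exp_convex]) auto
    finally show ?thesis using pos by (simp add: exp_diff)
  qed
  have "m ((1 - t) * x + t * y) * exp (- z)
      = A * exp (a * ((1 - t) * x + t * y) - z) + (1 - A) * exp (b * ((1 - t) * x + t * y) - z)"
    by (simp add: m_def exp_diff exp_minus divide_inverse distrib_right mult.assoc)
  also have "\<dots> \<le> A * ((1 - t) * (exp (a * x) / m x) + t * (exp (a * y) / m y))
      + (1 - A) * ((1 - t) * (exp (b * x) / m x) + t * (exp (b * y) / m y))"
    using A by (intro add_mono mult_left_mono tilt) auto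
  also have "\<dots> = (1 - t) * ((A * exp (a * x) + (1 - A) * exp (b * x)) / m x)
      + t * ((A * exp (a * y) + (1 - A) * exp (b * y)) / m y)"
    by (simp only: add_divide_distrib distrib_left times_divide_eq_right mult.left_commute
        add.commute add.left_commute)
  also have "\<dots> = (1 - t) * (m x / m x) + t * (m y / m y)" by (simp only: m_def)
  also have "\<dots> = 1" using pos[of x] pos[of y] by simp
  finally have "m ((1 - t) * x + t * y) \<le> exp z"
    by (simp add: exp_minus field_simps)
  then have "ln (m ((1 - t) * x + t * y)) \<le> z"
    by (metis ln_exp ln_le_cancel_iff pos exp_gt_zero)
  then show "ln (A * exp (a * ((1 - t) *\<^sub>R x + t *\<^sub>R y)) + (1 - A) * exp (b * ((1 - t) *\<^sub>R x + t *\<^sub>R y)))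
      \<le> (1 - t) * ln (A * exp (a * x) + (1 - A) * exp (b * x))
        + t * ln (A * exp (a * y) + (1 - A) * exp (b * y))"
    by (simp add: m_def z_def)
qed simp

lemma convex_on_log_mgf_bound:
  fixes K :: "'i::finite set"
  assumes w: "\<And>i. i \<in> K \<Longrightarrow> 0 \<le> bound_weight \<mu> u l i \<and> bound_weight \<mu> u l i \<le> 1"
  shows "convex_on UNIV (log_mgf_bound K h \<mu> u l)"
  unfolding log_mgf_bound_def
proof (rule convex_on_finite_sum)
  fix i assume i: "i \<in> K"
  let ?A = "bound_weight \<mu> u l i"
  have "linear (\<lambda>\<rho>. \<rho> $ i :: real)"
    by (intro bounded_linear.linear bounded_linear_vec_nth)
  from convex_on_linear_vimage[OF this convex_on_ln_exp_mix[of ?A "h * u i" "h * l i"]]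
  show "convex_on UNIV (\<lambda>\<rho> :: real ^ 'i. ln (?A * exp (h * \<rho> $ i * u i) + (1 - ?A) * exp (h * \<rho> $ i * l i)))"
    using w[OF i] by (simp add: ac_simps)
qed auto

lemma concave_on_powr:
  fixes a :: real
  assumes "0 \<le> a" and "a \<le> 1"
  shows "concave_on {0<..} (\<lambda>x. x powr a)"
proof (rule f''_le0_imp_concave)
  fix x :: real assume x: "x \<in> {0<..}"
  show "((\<lambda>x. x powr a) has_real_derivative a * x powr (a - 1)) (at x)"
    using x by (auto intro!: derivative_eq_intros)
  show "((\<lambda>x. a * x powr (a - 1)) has_real_derivative a * ((a - 1) * x powr (a - 1 - 1))) (at x)"
    using x by (auto intro!: derivative_eq_intros)
  show "a * ((a - 1) * x powr (a - 1 - 1)) \<le> 0"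
    using assms by (simp add: mult_nonneg_nonpos mult_nonpos_nonneg)
qed simp

lemma concave_on_one_minus_powr:
  fixes q :: real
  assumes "0 < q"
  shows "concave_on UNIV (\<lambda>t. 1 - q powr t)"
proof -
  have "linear (\<lambda>t. t * ln q)" by (simp add: linear_iff algebra_simps)
  from convex_on_linear_vimage[OF this exp_convex]
  have "convex_on UNIV (\<lambda>t. q powr t)" using assms by (simp add: powr_def)
  then show ?thesis
    by (intro concave_on_diff) (auto simp: concave_on_const)
qed

text \<open>
  Splitting off \<open>y powr (1 / \<theta>)\<close> and \<open>ln\<close> avoids differentiating the composite: each outer function
  is increasing and concave, so concavity passes through.
\<close>

lemma concave_on_ln_one_minus_powr_powr:
  fixes q \<theta> :: real
  assumes q: "0 < q" "q < 1" and "\<theta> \<ge> 1"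
  shows "concave_on {0<..} (\<lambda>y. ln (1 - q powr (y powr (1 / \<theta>))))"
proof -
  have "concave_on {0<..} (\<lambda>y. 1 - q powr (y powr (1 / \<theta>)))"
    using assms
    by (intro concave_on_compose_mono[OF concave_on_powr concave_on_one_minus_powr])
       (auto intro!: mono_onI powr_mono')
  then show ?thesis
    by (rule concave_on_compose_mono[OF _ ln_concave])
      (use q in \<open>auto intro!: mono_onI simp: powr01_less_one\<close>)
qed

text \<open>
  At \<open>y = 0\<close> the value \<open>0 powr (1 / \<theta>) = 0\<close> makes the risk \<open>1 - q powr 0\<close> vanish, so the point
  \<open>0\<close> joins the negative arguments and the real-valued branch lives on the open half-line.
\<close>

lemma log_risk_eq:
  assumes "0 < q" and "q < 1"
  shows "log_risk q \<theta> y = (if y > 0 then ereal (ln (1 - q powr (y powr (1 / \<theta>)))) else - \<infinity>)"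
proof -
  have "q powr (y powr (1 / \<theta>)) < 1" if "y > 0"
    using assms that by (simp add: powr01_less_one)
  then show ?thesis using assms by (cases "y = 0") (auto simp: log_risk_def ext_ln_def)
qed

text \<open>
  Points where an extended-valued function is infinite contribute nothing to its epigraph, so
  convexity needs to be known only on the set where it is finite.
\<close>

lemma convex_ext_onI:
  assumes f: "convex_on S f" and D: "convex D"
    and fin: "\<And>x. x \<in> D \<Longrightarrow> x \<in> S \<Longrightarrow> g x = ereal (f x)"
    and inf: "\<And>x. x \<in> D \<Longrightarrow> x \<notin> S \<Longrightarrow> g x = \<infinity>"
  shows "convex_ext_on D g"
proof -
  have "convex_on (D \<inter> S) f"
    by (rule convex_on_subset[OF f]) (use D f in \<open>auto intro: convex_Int convex_on_imp_convex\<close>)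
  moreover have "{(x, t :: real). x \<in> D \<and> g x \<le> ereal t} = epigraph (D \<inter> S) f"
  proof -
    have "x \<in> D \<and> g x \<le> ereal t \<longleftrightarrow> x \<in> D \<inter> S \<and> f x \<le> t" for x t
      using fin[of x] inf[of x] by (cases "x \<in> S") auto
    then show ?thesis by (auto simp: epigraph_def)
  qed
  ultimately show ?thesis by (simp add: convex_ext_on_def convex_epigraph)
qed

section \<open>The tail estimate\<close>

context prob_space
begin

lemma integrable_bounded:
  fixes X :: "'a \<Rightarrow> real"
  assumes "X \<in> borel_measurable M" and bnd: "\<And>\<omega>. \<omega> \<in> space M \<Longrightarrow> b \<le> X \<omega> \<and> X \<omega> \<le> b'"
  shows "integrable M X"
  using assms by (intro integrable_const_bound[where B = "max \<bar>b\<bar> \<bar>b'\<bar>"]) (auto intro!: AE_I2 dest!: bnd)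

text \<open>
  The weight is the position of the mean inside \<open>[l i, u i]\<close>, and the mean of a variable with
  values in that interval lies in it.
\<close>

lemma bound_weight_in_unit:
  assumes [measurable]: "X \<in> borel_measurable M"
    and bnd: "\<And>\<omega>. \<omega> \<in> space M \<Longrightarrow> l i \<le> X \<omega> \<and> X \<omega> \<le> u i" and "l i < u i"
    and \<mu>: "\<mu> i = expectation X"
  shows "0 \<le> bound_weight \<mu> u l i \<and> bound_weight \<mu> u l i \<le> 1"
proof -
  have int: "integrable M X" by (rule integrable_bounded[OF assms(1) bnd])
  have "l i \<le> \<mu> i" "\<mu> i \<le> u i"
    unfolding \<mu> using bnd by (auto intro!: integral_ge_const integral_le_const int)
  then show ?thesis using \<open>l i < u i\<close> by (simp add: bound_weight_def field_simps)
qed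

text \<open>
  Among the variables with given mean and range, the one taking only the two extreme values has
  the largest exponential moment: on the interval, \<open>exp (r * x)\<close> lies below its chord, and the
  expectation of the affine chord depends on the mean alone.
\<close>

lemma expectation_exp_le_bound_weight:
  fixes r :: real
  assumes [measurable]: "X \<in> borel_measurable M"
    and bnd: "\<And>\<omega>. \<omega> \<in> space M \<Longrightarrow> l i \<le> X \<omega> \<and> X \<omega> \<le> u i" and lu: "l i < u i"
    and \<mu>: "\<mu> i = expectation X"
  shows "integrable M (\<lambda>\<omega>. exp (r * X \<omega>))"
    and "expectation (\<lambda>\<omega>. exp (r * X \<omega>))
      \<le> bound_weight \<mu> u l i * exp (r * u i) + (1 - bound_weight \<mu> u l i) * exp (r * l i)"
proof -
  \<comment> \<open>The barycentric coordinate of \<open>x\<close> in \<open>[l i, u i]\<close>; its mean is the bound weight.\<close>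
  define W where "W = (\<lambda>x. (x - l i) / (u i - l i))"
  have int: "integrable M X" by (rule integrable_bounded[OF assms(1) bnd])
  have chord: "exp (r * X \<omega>) \<le> W (X \<omega>) * exp (r * u i) + (1 - W (X \<omega>)) * exp (r * l i)"
    if "\<omega> \<in> space M" for \<omega>
  proof -
    have W: "0 \<le> W (X \<omega>)" "W (X \<omega>) \<le> 1" using bnd[OF that] lu by (auto simp: W_def)
    have "X \<omega> = (1 - W (X \<omega>)) * l i + W (X \<omega>) * u i"
    proof -
      have "W (X \<omega>) * (u i - l i) = X \<omega> - l i" using lu by (simp add: W_def)
      then show ?thesis by (simp add: algebra_simps)
    qed
    then have "r * X \<omega> = (1 - W (X \<omega>)) *\<^sub>R (r * l i) + W (X \<omega>) *\<^sub>R (r * u i)"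
      by (metis (no_types, opaque_lifting) distrib_left mult.left_commute real_scaleR_def)
    with convex_onD[OF exp_convex W, of "r * l i" "r * u i"] show ?thesis by simp
  qed
  have intW: "integrable M (\<lambda>\<omega>. W (X \<omega>))" using int by (simp add: W_def)
  show int_exp: "integrable M (\<lambda>\<omega>. exp (r * X \<omega>))"
  proof (rule Bochner_Integration.integrable_bound)
    show "integrable M (\<lambda>\<omega>. W (X \<omega>) * exp (r * u i) + (1 - W (X \<omega>)) * exp (r * l i))"
      using intW by simp
    show "AE \<omega> in M. norm (exp (r * X \<omega>))
        \<le> norm (W (X \<omega>) * exp (r * u i) + (1 - W (X \<omega>)) * exp (r * l i))"
      using chord by (intro AE_I2) (smt (verit) exp_gt_zero real_norm_def)
  qed measurable
  have "expectation (\<lambda>\<omega>. exp (r * X \<omega>))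
      \<le> expectation (\<lambda>\<omega>. W (X \<omega>) * exp (r * u i) + (1 - W (X \<omega>)) * exp (r * l i))"
    using intW int_exp chord by (intro integral_mono) auto
  also have "\<dots> = expectation (\<lambda>\<omega>. W (X \<omega>)) * exp (r * u i)
      + (1 - expectation (\<lambda>\<omega>. W (X \<omega>))) * exp (r * l i)"
    using intW by (simp add: prob_space)
  also have "expectation (\<lambda>\<omega>. W (X \<omega>)) = bound_weight \<mu> u l i"
    using int by (simp add: W_def bound_weight_def \<mu> prob_space)
  finally show "expectation (\<lambda>\<omega>. exp (r * X \<omega>))
      \<le> bound_weight \<mu> u l i * exp (r * u i) + (1 - bound_weight \<mu> u l i) * exp (r * l i)" .
qed

text \<open>
  A Chernoff bound with the exponent \<open>h\<close> held fixed. The constraint on \<open>log_mgf_bound\<close> is the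
  logarithm of the resulting estimate of the complementary probability.
\<close>

lemma prob_weighted_sum_le:
  fixes K :: "'i::finite set" and \<rho> :: "real ^ 'i"
  assumes meas: "\<And>i. i \<in> K \<Longrightarrow> X i \<in> borel_measurable M"
    and indep: "indep_vars (\<lambda>_. borel) X K"
    and bnd: "\<And>i \<omega>. i \<in> K \<Longrightarrow> \<omega> \<in> space M \<Longrightarrow> l i \<le> X i \<omega> \<and> X i \<omega> \<le> u i"
    and lu: "\<And>i. i \<in> K \<Longrightarrow> l i < u i"
    and \<mu>: "\<And>i. i \<in> K \<Longrightarrow> \<mu> i = expectation (X i)"
    and "h > 0" and "q < 1"
    and le: "log_mgf_bound K h \<mu> u l \<rho> \<le> ln (1 - q) + h * z"
  shows "q \<le> prob {\<omega> \<in> space M. (\<Sum>i \<in> K. \<rho> $ i * X i \<omega>) \<le> z}"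
proof -
  define Y where "Y = (\<lambda>\<omega>. \<Sum>i \<in> K. \<rho> $ i * X i \<omega>)"
  define m where "m = (\<lambda>i. bound_weight \<mu> u l i * exp (h * \<rho> $ i * u i)
      + (1 - bound_weight \<mu> u l i) * exp (h * \<rho> $ i * l i))"
  have [measurable]: "Y \<in> borel_measurable M" unfolding Y_def using meas by auto
  have exp_bound: "integrable M (\<lambda>\<omega>. exp (h * \<rho> $ i * X i \<omega>))"
      "expectation (\<lambda>\<omega>. exp (h * \<rho> $ i * X i \<omega>)) \<le> m i" if "i \<in> K" for i
    unfolding m_def
    using expectation_exp_le_bound_weight[where X = "X i" and i = i and l = l and u = u and \<mu> = \<mu>]
      that meas bnd lu \<mu> by blast+
  have m_pos: "m i > 0" if "i \<in> K" for i
    unfolding m_def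
    using bound_weight_in_unit[of "X i" l i u \<mu>] that meas bnd lu \<mu> by (intro exp_mix_pos) auto
  have exp_Y: "exp (h * Y \<omega>) = (\<Prod>i \<in> K. exp (h * \<rho> $ i * X i \<omega>))" for \<omega>
    by (simp add: Y_def sum_distrib_left exp_sum mult.assoc)
  have indep': "indep_vars (\<lambda>_. borel) (\<lambda>i \<omega>. exp (h * \<rho> $ i * X i \<omega>)) K"
    by (rule indep_vars_compose2[OF indep]) simp
  have int: "integrable M (\<lambda>\<omega>. exp (h * Y \<omega>))"
    unfolding exp_Y by (rule indep_vars_integrable[OF _ indep' exp_bound(1)]) auto
  have "prob {\<omega> \<in> space M. \<not> Y \<omega> \<le> z} \<le> prob {\<omega> \<in> space M. Y \<omega> \<ge> z}"
    by (intro finite_measure_mono) auto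
  also have "\<dots> \<le> exp (- h * z) * (\<integral>\<omega>\<in>space M. exp (h * Y \<omega>) \<partial>M)"
    using \<open>h > 0\<close> integrable_mult_indicator[OF sets.top int]
    by (intro Chernoff_ineq_ge) (auto simp: set_integrable_def)
  also have "(\<integral>\<omega>\<in>space M. exp (h * Y \<omega>) \<partial>M) = (\<Prod>i \<in> K. expectation (\<lambda>\<omega>. exp (h * \<rho> $ i * X i \<omega>)))"
    unfolding set_integral_space[OF int] unfolding exp_Y
    by (rule indep_vars_lebesgue_integral[OF _ indep' exp_bound(1)]) auto
  also have "\<dots> \<le> (\<Prod>i \<in> K. m i)"
    by (intro prod_mono conjI exp_bound(2)) simp_all
  also have "\<dots> = exp (\<Sum>i \<in> K. ln (m i))"
    using m_pos by (simp add: exp_sum)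
  also have "exp (- h * z) * \<dots> \<le> exp (ln (1 - q))"
    using le by (simp add: log_mgf_bound_def m_def flip: exp_add)
  also have "\<dots> = 1 - q" using \<open>q < 1\<close> by simp
  finally have "prob {\<omega> \<in> space M. \<not> Y \<omega> \<le> z} \<le> 1 - q" by simp
  moreover have "prob {\<omega> \<in> space M. \<not> Y \<omega> \<le> z} = 1 - prob {\<omega> \<in> space M. Y \<omega> \<le> z}"
    by (rule prob_neg) measurable
  ultimately show ?thesis by (simp add: Y_def)
qed

end

section \<open>The approximating program\<close>

lemma subspace_vecs_on: "subspace (vecs_on K)"
  by (auto simp: subspace_def vecs_on_def)

lemma affine_fun_on_balance:
  "affine_fun_on D (\<lambda>(z :: real, \<rho>, y :: real ^ 'k::finite). balance Act \<alpha> \<gamma> p s' \<rho>)"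
  unfolding affine_fun_on_def
proof (intro exI conjI ballI)
  show "linear (\<lambda>(z :: real, \<rho>, y :: real ^ 'k). \<Sum>(s, a) \<in> state_actions Act.
      \<rho> $ (s, a) * (of_bool (s' = s) - \<alpha> * pmf (p s a) s'))"
    by (auto simp: linear_iff case_prod_beta sum.distrib sum_distrib_left distrib_right mult.assoc)
qed (auto simp: balance_def)

lemma convex_program_rc_program:
  fixes Act :: "'s::finite \<Rightarrow> 'a::finite set" and h :: "'k::finite \<Rightarrow> real"
  assumes "0 < p1" and "p1 < 1" and "\<theta> \<ge> 1"
    and wc: "\<And>i. i \<in> state_actions Act \<Longrightarrow>
      0 \<le> bound_weight \<mu>c cu cl i \<and> bound_weight \<mu>c cu cl i \<le> 1"
    and wd: "\<And>k i. i \<in> state_actions Act \<Longrightarrow>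
      0 \<le> bound_weight (\<mu>d k) (du k) (dl k) i \<and> bound_weight (\<mu>d k) (du k) (dl k) i \<le> 1"
  shows "convex_program (rc_program Act \<alpha> \<gamma> p \<mu>c cu cl \<mu>d du dl \<xi> p0 p1 \<theta> h0 h)"
proof -
  let ?D = "UNIV \<times> vecs_on (state_actions Act) \<times> UNIV :: ('s, 'a, 'k) decision set"
  have sub: "subspace ?D"
    by (intro subspace_Times subspace_UNIV subspace_vecs_on)
  have obj: "linear_fun_on ?D (\<lambda>(z, \<rho>, y). z)"
    unfolding linear_fun_on_def by (rule exI[of _ fst]) (auto simp: linear_iff)
  have aff_y: "affine_fun_on ?D (\<lambda>(z, \<rho>, y). (\<Sum>k \<in> UNIV. y $ k) - 1)"
    unfolding affine_fun_on_def
    by (rule exI[of _ "\<lambda>(z, \<rho>, y). (\<Sum>k \<in> UNIV. y $ k)"], rule exI[of _ "- 1"])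
       (auto simp: linear_iff sum.distrib sum_distrib_left)
  have aff_yk: "affine_fun_on ?D (\<lambda>(z, \<rho>, y). - y $ k)" for k
    unfolding affine_fun_on_def
    by (rule exI[of _ "\<lambda>(z, \<rho>, y). - y $ k"], rule exI[of _ 0]) (auto simp: linear_iff)
  have aff_\<rho>: "affine_fun_on ?D (\<lambda>(z, \<rho>, y). - \<rho> $ i)" for i
    unfolding affine_fun_on_def
    by (rule exI[of _ "\<lambda>(z, \<rho>, y). - \<rho> $ i"], rule exI[of _ 0]) (auto simp: linear_iff)
  have lin_\<rho>: "linear (\<lambda>x :: ('s, 'a, 'k) decision. fst (snd x))" by (simp add: linear_iff)
  have lin_y: "linear (\<lambda>x :: ('s, 'a, 'k) decision. snd (snd x) $ k)" for k
    by (simp add: linear_iff)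
  have ext0: "convex_ext_on ?D (\<lambda>(z, \<rho>, y).
      ereal (log_mgf_bound (state_actions Act) h0 \<mu>c cu cl \<rho> - (ln (1 - p0) + h0 * z)))"
  proof (rule convex_ext_onI)
    have "linear (\<lambda>x :: ('s, 'a, 'k) decision. - h0 * fst x)"
      by (simp add: linear_iff algebra_simps)
    from convex_on_linear_vimage[OF this, of UNIV "\<lambda>t. t"]
    have obj_part: "convex_on UNIV (\<lambda>x :: ('s, 'a, 'k) decision. - h0 * fst x)"
      by (simp add: convex_on_ident)
    have "convex_on UNIV (\<lambda>x :: ('s, 'a, 'k) decision.
        log_mgf_bound (state_actions Act) h0 \<mu>c cu cl (fst (snd x)))"
      using convex_on_linear_vimage[OF lin_\<rho> convex_on_log_mgf_bound[OF wc]] by simp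
    from convex_on_add[OF convex_on_add[OF this obj_part] convex_on_const[THEN iffD2, OF convex_UNIV]]
    show "convex_on UNIV (\<lambda>x :: ('s, 'a, 'k) decision.
        log_mgf_bound (state_actions Act) h0 \<mu>c cu cl (fst (snd x)) + - h0 * fst x + - ln (1 - p0))" .
  qed (auto simp: subspace_imp_convex[OF sub])
  have extk: "convex_ext_on ?D (\<lambda>(z, \<rho>, y).
      ereal (log_mgf_bound (state_actions Act) (h k) (\<mu>d k) (du k) (dl k) \<rho>)
        - (log_risk p1 \<theta> (y $ k) + ereal (h k * \<xi> k)))" for k
  proof (rule convex_ext_onI)
    let ?S = "{x :: ('s, 'a, 'k) decision. snd (snd x) $ k > 0}"
    have risk: "convex_on ?S (\<lambda>x. - ln (1 - p1 powr (snd (snd x) $ k powr (1 / \<theta>))))"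
      using convex_on_linear_vimage[OF lin_y[of k],
          OF concave_on_ln_one_minus_powr_powr[OF assms(1-3), unfolded concave_on_def]]
      by (simp add: vimage_def)
    then have S: "convex ?S" by (rule convex_on_imp_convex)
    have "convex_on UNIV (\<lambda>x :: ('s, 'a, 'k) decision.
        log_mgf_bound (state_actions Act) (h k) (\<mu>d k) (du k) (dl k) (fst (snd x)))"
      using convex_on_linear_vimage[OF lin_\<rho> convex_on_log_mgf_bound[OF wd]] by simp
    then have "convex_on ?S (\<lambda>x :: ('s, 'a, 'k) decision.
        log_mgf_bound (state_actions Act) (h k) (\<mu>d k) (du k) (dl k) (fst (snd x)))"
      using S by (auto intro: convex_on_subset)
    from convex_on_add[OF convex_on_add[OF this risk] convex_on_const[THEN iffD2, OF S]]
    show "convex_on ?S (\<lambda>x. log_mgf_bound (state_actions Act) (h k) (\<mu>d k) (du k) (dl k) (fst (snd x))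
        + - ln (1 - p1 powr (snd (snd x) $ k powr (1 / \<theta>))) + - (h k * \<xi> k))" .
  qed (auto simp: subspace_imp_convex[OF sub] log_risk_eq[OF assms(1,2)])
  show ?thesis
    unfolding convex_program_def rc_program_def
    using sub obj aff_y aff_yk aff_\<rho> affine_fun_on_balance ext0 extk
    by (auto simp del: Product_Type.split_paired_All)
qed

theorem theorem6:
  fixes Act :: "'s::finite \<Rightarrow> 'a::finite set"
    and \<alpha> :: real
    and \<gamma> :: "'s pmf"
    and p :: "'s \<Rightarrow> 'a \<Rightarrow> 's pmf"
    and M :: "'w measure"
    and c :: "'s \<times> 'a \<Rightarrow> 'w \<Rightarrow> real"
    and d :: "'k::finite \<Rightarrow> 's \<times> 'a \<Rightarrow> 'w \<Rightarrow> real"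
    and \<mu>c cu cl :: "'s \<times> 'a \<Rightarrow> real"
    and \<mu>d du dl :: "'k \<Rightarrow> 's \<times> 'a \<Rightarrow> real"
    and \<xi> h :: "'k \<Rightarrow> real"
    and p0 p1 \<theta> h0 :: real
  assumes "\<And>s. Act s \<noteq> {}"
    and "0 < \<alpha>" and "\<alpha> < 1"
    and "0 < p0" and "p0 < 1" and "0 < p1" and "p1 < 1" and "\<theta> \<ge> 1"
    and "prob_space M"
    and "\<And>i. i \<in> state_actions Act \<Longrightarrow> c i \<in> borel_measurable M"
    and "\<And>k i. i \<in> state_actions Act \<Longrightarrow> d k i \<in> borel_measurable M"
    and "prob_space.indep_vars M (\<lambda>_. borel) c (state_actions Act)"
    and "\<And>k. prob_space.indep_vars M (\<lambda>_. borel) (d k) (state_actions Act)"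
    and "\<And>i. i \<in> state_actions Act \<Longrightarrow> \<mu>c i = prob_space.expectation M (c i)"
    and "\<And>k i. i \<in> state_actions Act \<Longrightarrow> \<mu>d k i = prob_space.expectation M (d k i)"
    and "\<And>i \<omega>. i \<in> state_actions Act \<Longrightarrow> \<omega> \<in> space M \<Longrightarrow> cl i \<le> c i \<omega> \<and> c i \<omega> \<le> cu i"
    and "\<And>k i \<omega>. i \<in> state_actions Act \<Longrightarrow> \<omega> \<in> space M \<Longrightarrow> dl k i \<le> d k i \<omega> \<and> d k i \<omega> \<le> du k i"
    and "\<And>i. i \<in> state_actions Act \<Longrightarrow> cl i < cu i"
    and "\<And>k i. i \<in> state_actions Act \<Longrightarrow> dl k i < du k i"
    and "h0 > 0" and "\<And>k. h k > 0"
  shows "convex_program (rc_program Act \<alpha> \<gamma> p \<mu>c cu cl \<mu>d du dl \<xi> p0 p1 \<theta> h0 h)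
    \<and> iccp_value Act \<alpha> \<gamma> p M c d \<xi> p0 p1 \<theta>
        \<le> opt_value (objective (rc_program Act \<alpha> \<gamma> p \<mu>c cu cl \<mu>d du dl \<xi> p0 p1 \<theta> h0 h))
            (feasible_set (rc_program Act \<alpha> \<gamma> p \<mu>c cu cl \<mu>d du dl \<xi> p0 p1 \<theta> h0 h))"
proof
  interpret prob_space M by fact
  have wc: "0 \<le> bound_weight \<mu>c cu cl i \<and> bound_weight \<mu>c cu cl i \<le> 1"
    if "i \<in> state_actions Act" for i
    using bound_weight_in_unit[of "c i" cl i cu \<mu>c] that assms by blast
  have wd: "0 \<le> bound_weight (\<mu>d k) (du k) (dl k) i \<and> bound_weight (\<mu>d k) (du k) (dl k) i \<le> 1"
    if "i \<in> state_actions Act" for k i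
    using bound_weight_in_unit[of "d k i" "dl k" i "du k" "\<mu>d k"] that assms by blast
  let ?P = "rc_program Act \<alpha> \<gamma> p \<mu>c cu cl \<mu>d du dl \<xi> p0 p1 \<theta> h0 h"
  show "convex_program ?P"
    using assms wc wd by (intro convex_program_rc_program)
  have "feasible_set ?P \<subseteq> iccp_feasible Act \<alpha> \<gamma> p M c d \<xi> p0 p1 \<theta>"
  proof (clarify, unfold feasible_set_rc_program iccp_feasible_def mem_Collect_eq prod.case,
      elim conjE, intro conjI allI)
    fix z :: real and \<rho> :: "real ^ ('s \<times> 'a)" and y :: "real ^ 'k"
    assume 0: "log_mgf_bound (state_actions Act) h0 \<mu>c cu cl \<rho> \<le> ln (1 - p0) + h0 * z"
      and k: "\<forall>k. ereal (log_mgf_bound (state_actions Act) (h k) (\<mu>d k) (du k) (dl k) \<rho>)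
        \<le> ext_ln (1 - p1 powr (y $ k powr (1 / \<theta>))) + ereal (h k * \<xi> k)"
    show "p0 \<le> prob {\<omega> \<in> space M. (\<Sum>i \<in> state_actions Act. \<rho> $ i * c i \<omega>) \<le> z}"
      by (rule prob_weighted_sum_le[OF _ _ _ _ _ _ _ 0]) (use assms in auto)
    fix k
    define q where "q = p1 powr (y $ k powr (1 / \<theta>))"
    \<comment> \<open>The left-hand side is finite, which excludes the value \<open>- \<infinity>\<close> on the right, hence \<open>q \<ge> 1\<close>.\<close>
    from k have *: "ereal (log_mgf_bound (state_actions Act) (h k) (\<mu>d k) (du k) (dl k) \<rho>)
        \<le> ext_ln (1 - q) + ereal (h k * \<xi> k)" unfolding q_def by blast
    then have "q < 1" by (auto simp: ext_ln_def split: if_splits)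
    with * have "log_mgf_bound (state_actions Act) (h k) (\<mu>d k) (du k) (dl k) \<rho> \<le> ln (1 - q) + h k * \<xi> k"
      by (simp add: ext_ln_def)
    then show "q \<le> prob {\<omega> \<in> space M. (\<Sum>i \<in> state_actions Act. \<rho> $ i * d k i \<omega>) \<le> \<xi> k}"
      by (rule prob_weighted_sum_le[rotated -1]) (use assms \<open>q < 1\<close> in auto)
  qed auto
  then show "iccp_value Act \<alpha> \<gamma> p M c d \<xi> p0 p1 \<theta> \<le> opt_value (objective ?P) (feasible_set ?P)"
    unfolding iccp_value_def opt_value_def
    by (simp add: rc_program_def INF_superset_mono)
qed

end
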